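(* Let $R$ be a ring, $M$ a left $R$-module and $N\subseteq M$ a subset. Then $N$ is an equivalence class for a congruence on the $R$-module $M$ if and only if $N$ is an induced submodule of the $\mathrm{T}(R)$-module $\mathrm{T}(M)$.
   Context: For a ring $R$, $\mathrm{T}(R)$ denotes the associated truss: the set $R$ with the ternary operation $[a,b,c]=a-b+c$ and the multiplication of $R$. For a left $R$-module $M$, $\mathrm{T}(M)$ denotes the set $M$ with the ternary operation $[m,m',m'']=m-m'+m''$ and the same action of the elements of $R$; it is a module over $\mathrm{T}(R)$. A sub-heap of $\mathrm{T}(M)$ is a subset closed under $[-,-,-]$. An induced submodule of $\mathrm{T}(M)$ is a sub-heap $N$ such that $[r e',r e,e]=re'-re+e\in N$ for all $e,e'\in N$ and $r\in R$. A congruence on an $R$-module $M$ is an equivalence relation compatible with addition and with the action of $R$.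
   Formalization: Induced submodules are required to be non-empty, since the empty set vacuously satisfies the definition of an induced submodule but is never an equivalence class. *)

theory Defs
  imports Complex_Main
begin

text \<open>
  The class \<^class>\<open>ring\<close> is that of associative rings, not necessarily with identity. The library
  locale \<^locale>\<open>module\<close> requires a commutative ring with identity, hence the locale below. No
  identity is assumed, so unital modules over unital rings are a special case.
\<close>

locale left_module =
  fixes scale :: "'r::ring \<Rightarrow> 'm::ab_group_add \<Rightarrow> 'm"
  assumes scale_add_right: "scale r (x + y) = scale r x + scale r y"
    and scale_add_left: "scale (r + s) x = scale r x + scale s x"
    and scale_mult: "scale (r * s) x = scale r (scale s x)"

definition module_congruence ::
    "('r::ring \<Rightarrow> 'm::ab_group_add \<Rightarrow> 'm) \<Rightarrow> ('m \<times> 'm) set \<Rightarrow> bool"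
  where "module_congruence scale C \<longleftrightarrow>
    equiv UNIV C \<and>
    (\<forall>x x' y y'. (x, x') \<in> C \<longrightarrow> (y, y') \<in> C \<longrightarrow> (x + y, x' + y') \<in> C) \<and>
    (\<forall>r x x'. (x, x') \<in> C \<longrightarrow> (scale r x, scale r x') \<in> C)"

locale abelian_heap =
  fixes br :: "'a \<Rightarrow> 'a \<Rightarrow> 'a \<Rightarrow> 'a"
  assumes br_assoc: "br (br a b c) d e = br a b (br c d e)"
    and br_left: "br a a b = b"
    and br_right: "br b a a = b"
    and br_commute: "br a b c = br c b a"

locale truss = abelian_heap br
  for br :: "'t \<Rightarrow> 't \<Rightarrow> 't \<Rightarrow> 't" +
  fixes mul :: "'t \<Rightarrow> 't \<Rightarrow> 't"
  assumes mul_assoc: "mul (mul s t) u = mul s (mul t u)"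
    and mul_br_right: "mul s (br t u v) = br (mul s t) (mul s u) (mul s v)"
    and mul_br_left: "mul (br t u v) s = br (mul t s) (mul u s) (mul v s)"

locale truss_module = truss br mul + M: abelian_heap brM
  for br :: "'t \<Rightarrow> 't \<Rightarrow> 't \<Rightarrow> 't" and mul :: "'t \<Rightarrow> 't \<Rightarrow> 't"
    and brM :: "'m \<Rightarrow> 'm \<Rightarrow> 'm \<Rightarrow> 'm" +
  fixes act :: "'t \<Rightarrow> 'm \<Rightarrow> 'm"
  assumes act_mul: "act (mul s t) x = act s (act t x)"
    and act_br_left: "act (br s t u) x = brM (act s x) (act t x) (act u x)"
    and act_br_right: "act s (brM x y z) = brM (act s x) (act s y) (act s z)"

definition sub_heap :: "('m \<Rightarrow> 'm \<Rightarrow> 'm \<Rightarrow> 'm) \<Rightarrow> 'm set \<Rightarrow> bool"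
  where "sub_heap br N \<longleftrightarrow> (\<forall>x\<in>N. \<forall>y\<in>N. \<forall>z\<in>N. br x y z \<in> N)"

text \<open>
  The empty set is vacuously closed under all the operations; it is excluded, since an equivalence
  class is never empty.
\<close>

definition induced_submodule ::
    "('m \<Rightarrow> 'm \<Rightarrow> 'm \<Rightarrow> 'm) \<Rightarrow> ('t \<Rightarrow> 'm \<Rightarrow> 'm) \<Rightarrow> 'm set \<Rightarrow> bool"
  where "induced_submodule br act N \<longleftrightarrow>
    N \<noteq> {} \<and> sub_heap br N \<and> (\<forall>e\<in>N. \<forall>e'\<in>N. \<forall>r. br (act r e') (act r e) e \<in> N)"

text \<open>
  \<open>T_bracket\<close> is the heap operation of both \<open>T(R)\<close> and \<open>T(M)\<close>; the multiplication
  of \<open>T(R)\<close> and its action on \<open>T(M)\<close> are those of \<open>R\<close>.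
\<close>

definition T_bracket :: "'a::ab_group_add \<Rightarrow> 'a \<Rightarrow> 'a \<Rightarrow> 'a"
  where "T_bracket a b c = a - b + c"

lemma (in left_module) scale_diff_right: "scale r (x - y) = scale r x - scale r y"
  by (metis add_diff_cancel diff_add_cancel scale_add_right)

lemma (in left_module) scale_diff_left: "scale (r - s) x = scale r x - scale s x"
  by (metis add_diff_cancel diff_add_cancel scale_add_left)

lemma (in left_module) truss_module_T:
  "truss_module T_bracket (*) T_bracket scale"
  by unfold_locales
    (simp_all add: T_bracket_def algebra_simps scale_mult scale_add_right scale_add_left
      scale_diff_right scale_diff_left)

end

theory Submission
  imports Defs
begin

text \<open>
  A congruence is compatible with the heap operation, and \<open>re' - re + e\<close> is congruent to \<open>e\<close>
  whenever \<open>e'\<close> is, so its classes are induced submodules. Conversely, for \<open>e\<close> in an induced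
  submodule \<open>N\<close>, the translate \<open>N - e\<close> is a subgroup closed under the action, and \<open>N\<close> is the
  class of \<open>e\<close> modulo this submodule.
\<close>

lemma module_congruence_class_induced:
  assumes "module_congruence scale C" and "N \<in> UNIV // C"
  shows "induced_submodule T_bracket scale N"
proof -
  have C: "equiv UNIV C"
    and add: "\<And>x x' y y'. (x, x') \<in> C \<Longrightarrow> (y, y') \<in> C \<Longrightarrow> (x + y, x' + y') \<in> C"
    and act: "\<And>r x x'. (x, x') \<in> C \<Longrightarrow> (scale r x, scale r x') \<in> C"
    using assms(1) unfolding module_congruence_def by blast+
  have refl: "(x, x) \<in> C" for x
    using C by (simp add: equiv_def refl_on_def)
  \<comment> \<open>Negation needs no separate compatibility: adding the reflexive pair of
    \<open>- y\<close> moves the pair to \<open>0\<close>.\<close>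
  have minus: "(x - y, 0) \<in> C" if "(x, y) \<in> C" for x y
    using add[OF that refl[of "- y"]] by simp
  have bracket: "(c, T_bracket x y c) \<in> C" if "(x, y) \<in> C" for x y c
  proof -
    have "(x - y + c, c) \<in> C"
      using add[OF minus[OF that] refl[of c]] by simp
    then show ?thesis
      using C by (auto simp: T_bracket_def equiv_def sym_def)
  qed
  \<comment> \<open>Any member of \<open>N\<close> serves as its representative.\<close>
  have class_iff: "x \<in> N \<longleftrightarrow> (a, x) \<in> C" if "a \<in> N" for a x
    using quotient_eq_iff[OF C assms(2) assms(2) that] in_quotient_imp_closed[OF C assms(2) that]
    by blast
  have "N \<noteq> {}"
    by (rule in_quotient_imp_non_empty[OF C assms(2)])
  moreover have "T_bracket x y z \<in> N" if "x \<in> N" "y \<in> N" "z \<in> N" for x y z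
    using class_iff bracket that by blast
  \<comment> \<open>\<open>act\<close> relates \<open>scale r x\<close> to \<open>scale r e\<close>;
    then \<open>bracket\<close> applies with \<open>c = e\<close>.\<close>
  moreover have "T_bracket (scale r x) (scale r e) e \<in> N" if "e \<in> N" "x \<in> N" for e x r
    using class_iff bracket act that by blast
  ultimately show ?thesis
    by (simp add: induced_submodule_def sub_heap_def)
qed

lemma induced_submodule_class:
  assumes "left_module scale" and "induced_submodule T_bracket scale N"
  shows "\<exists>C. module_congruence scale C \<and> N \<in> UNIV // C"
proof -
  interpret left_module scale by fact
  have heap: "\<And>x y z. x \<in> N \<Longrightarrow> y \<in> N \<Longrightarrow> z \<in> N \<Longrightarrow> x - y + z \<in> N"
    and act: "\<And>r e e'. e \<in> N \<Longrightarrow> e' \<in> N \<Longrightarrow> scale r e' - scale r e + e \<in> N"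
    and "N \<noteq> {}"
    using assms(2) by (auto simp: induced_submodule_def sub_heap_def T_bracket_def)
  then obtain e where e: "e \<in> N"
    by blast
  \<comment> \<open>The relation says that \<open>y - x\<close> lies in the translate of
    \<open>N\<close> by \<open>- e\<close>.\<close>
  define C where "C = {(x, y). y - x + e \<in> N}"
  have "equiv UNIV C"
  proof (rule equivI)
    show "refl C"
      by (simp add: C_def refl_on_def e)
    show "sym C"
    proof (rule symI)
      fix x y
      assume "(x, y) \<in> C"
      then show "(y, x) \<in> C"
        \<comment> \<open>The bracket \<open>e - n + e\<close> is negation when \<open>e\<close> is
          taken as zero.\<close>
        using heap[OF e _ e, of "y - x + e"] by (simp add: C_def algebra_simps)
    qed
    show "trans C"
    proof (rule transI)
      fix x y z
      assume "(x, y) \<in> C" "(y, z) \<in> C"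
      then show "(x, z) \<in> C"
        \<comment> \<open>A bracket with middle term \<open>e\<close> is addition with
          \<open>e\<close> as zero, so the differences telescope.\<close>
        using heap[OF _ e, of "z - y + e" "y - x + e"] by (simp add: C_def algebra_simps)
    qed
  qed simp
  moreover have "(x + y, x' + y') \<in> C" if "(x, x') \<in> C" "(y, y') \<in> C" for x x' y y'
    using heap[OF _ e, of "x' - x + e" "y' - y + e"] that by (simp add: C_def algebra_simps)
  moreover have "(scale r x, scale r x') \<in> C" if "(x, x') \<in> C" for r x x'
    \<comment> \<open>Expanding \<open>scale r (x' - x + e)\<close>, the terms
      \<open>scale r e\<close> cancel.\<close>
    using act[OF e, of "x' - x + e" r] that
    by (simp add: C_def scale_add_right scale_diff_right)
  ultimately have "module_congruence scale C"
    by (simp add: module_congruence_def)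
  moreover have "C `` {e} = N"
    by (auto simp: C_def)
  then have "N \<in> UNIV // C"
    by (metis UNIV_I quotientI)
  ultimately show ?thesis
    by blast
qed

theorem corollary3p2:
  fixes scale :: "'r::ring \<Rightarrow> 'm::ab_group_add \<Rightarrow> 'm"
    and N :: "'m set"
  assumes "left_module scale"
  shows "(\<exists>C. module_congruence scale C \<and> N \<in> UNIV // C) \<longleftrightarrow>
    induced_submodule T_bracket scale N"
  using module_congruence_class_induced induced_submodule_class[OF assms] by blast

end
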